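(* Let $G=(V_1,E_1)$ and $H=(V_2,E_2)$ be digraphs and let $P$ be any one of the following properties: Taylor; $\operatorname{SD}(\wedge)$; Hobby–McKenzie; $\operatorname{SD}(\vee)$; congruence modular (CM); congruence $n$-permutable for some $n$ (C$n$P); congruence distributive (CD); $\operatorname{SD}(\vee)$ and C$n$P; C$n$P and CM; CD and C$n$P; congruence $3$-permutable (C3P); CD and C3P; Maltsev; arithmetical (CD and Maltsev). If both $G$ and $H$ have $P$, then so do $G\mathbin{\dot\cup}H$ and $G\mathbin{\overline{\cup}}H$. Moreover, if $G$ or $H$ fails $P$, then $G\mathbin{\overline{\cup}}H$ also fails $P$.
   Context: Digraphs are finite and loopless. $G\mathbin{\dot\cup}H$ is the disjoint union digraph on $V_1\dot\cup V_2$ with edge set $E_1\cup E_2$. $G\mathbin{\overline{\cup}}H$ is the structure on $V_1\dot\cup V_2$ with binary relation $E_1\cup E_2$ together with two unary relations interpreted as $V_1$ and $V_2$. A polymorphism of a structure of arity $k$ is a map $f$ from $k$-tuples of elements to elements such that applying $f$ coordinatewise to $k$ tuples of any relation yields a tuple of that relation. A structure "has" a property below if it has polymorphisms satisfying the indicated equations for all values of the variables. Weak NU: an idempotent polymorphism $w$ of arity $n>1$ with $w(y,x,\dots,x)=w(x,y,x,\dots,x)=\dots=w(x,\dots,x,y)$. Taylor: has a weak NU polymorphism. $\operatorname{SD}(\wedge)$: a $3$-ary weak NU $w_1$ and a $4$-ary weak NU $w_2$ with $w_1(y,x,x)=w_2(y,x,x,x)$. Hobby–McKenzie: there are $n\ge0$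 and idempotent ternary polymorphisms $d_0,\dots,d_n,p,e_0,\dots,e_n$ with $x=d_0(x,y,z)$, $e_n(x,y,z)=z$; $d_i(x,y,y)=d_{i+1}(x,y,y)$ and $e_i(x,y,y)=e_{i+1}(x,y,y)$ for even $i<n$; $d_i(x,x,y)=d_{i+1}(x,x,y)$ and $e_i(x,x,y)=e_{i+1}(x,x,y)$ for odd $i<n$; $d_n(x,y,y)=p(x,y,y)$ and $p(x,x,y)=e_0(x,x,y)$; $d_i(x,y,x)=d_{i+1}(x,y,x)$ for odd $i<n$ and $e_j(x,y,x)=e_{j+1}(x,y,x)$ for even $j<n$. $\operatorname{SD}(\vee)$: both $\operatorname{SD}(\wedge)$ and Hobby–McKenzie. Congruence $n$-permutable: ternary polymorphisms $p_0,\dots,p_n$ with $p_0(x,y,z)=x$, $p_i(x,x,y)=p_{i+1}(x,y,y)$ for $i<n$, $p_n(x,y,z)=z$; Maltsev means congruence $2$-permutable. CD: ternary polymorphisms $J_0,\dots,J_n$ with $J_0(x,y,z)=x$, $J_i(x,y,x)=x$, $J_i(x,x,y)=J_{i+1}(x,x,y)$ for even $i<n$, $J_i(x,y,y)=J_{i+1}(x,y,y)$ for odd $i<n$, $J_n(x,y,z)=z$. CM: ternary polymorphisms $s_0,\dots,s_{2n},p$ with $s_0(x,y,z)=x$, $s_i(x,y,x)=x$, $s_i(x,y,y)=s_{i+1}(x,y,y)$ for even $i<2n$, $s_i(x,x,y)=s_{i+1}(x,x,y)$ for odd $i<2n$, $s_{2n}(x,y,y)=p(x,y,y)$, $p(x,x,y)=y$.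 Combined properties ("X and Y") mean both hold. *)

theory Defs
  imports Main
begin

type_synonym 'a struct = "'a set \<times> ('a \<times> 'a) set \<times> 'a set list"

definition dom_of :: "'a struct \<Rightarrow> 'a set" where "dom_of S = fst S"
definition rel_of :: "'a struct \<Rightarrow> ('a \<times> 'a) set" where "rel_of S = fst (snd S)"
definition unaries_of :: "'a struct \<Rightarrow> 'a set list" where "unaries_of S = snd (snd S)"

type_synonym 'a digraph = "'a set \<times> ('a \<times> 'a) set"

definition digraph :: "'a digraph \<Rightarrow> bool" where
  "digraph G \<longleftrightarrow> finite (fst G) \<and> snd G \<subseteq> fst G \<times> fst G \<and> (\<forall>x. (x, x) \<notin> snd G)"

definition struct_of :: "'a digraph \<Rightarrow> 'a struct" where
  "struct_of G = (fst G, snd G, [])"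

definition dunion :: "'a digraph \<Rightarrow> 'b digraph \<Rightarrow> ('a + 'b) digraph" where
  "dunion G H = (Inl ` fst G \<union> Inr ` fst H,
                 (\<lambda>(x, y). (Inl x, Inl y)) ` snd G \<union> (\<lambda>(x, y). (Inr x, Inr y)) ` snd H)"

definition ounion :: "'a digraph \<Rightarrow> 'b digraph \<Rightarrow> ('a + 'b) struct" where
  "ounion G H = (fst (dunion G H), snd (dunion G H), [Inl ` fst G, Inr ` fst H])"

definition polymorphism :: "'a struct \<Rightarrow> nat \<Rightarrow> ('a list \<Rightarrow> 'a) \<Rightarrow> bool" where
  "polymorphism S k f \<longleftrightarrow>
     (\<forall>xs. length xs = k \<and> set xs \<subseteq> dom_of S \<longrightarrow> f xs \<in> dom_of S) \<and>
     (\<forall>xs ys. length xs = k \<and> length ys = k \<and> (\<forall>i<k. (xs ! i, ys ! i) \<in> rel_of S)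
              \<longrightarrow> (f xs, f ys) \<in> rel_of S) \<and>
     (\<forall>U \<in> set (unaries_of S). \<forall>xs. length xs = k \<and> set xs \<subseteq> U \<longrightarrow> f xs \<in> U)"

definition pol3 :: "'a struct \<Rightarrow> ('a \<Rightarrow> 'a \<Rightarrow> 'a \<Rightarrow> 'a) \<Rightarrow> bool" where
  "pol3 S p \<longleftrightarrow> polymorphism S 3 (\<lambda>xs. p (xs ! 0) (xs ! 1) (xs ! 2))"

definition idem3 :: "'a struct \<Rightarrow> ('a \<Rightarrow> 'a \<Rightarrow> 'a \<Rightarrow> 'a) \<Rightarrow> bool" where
  "idem3 S p \<longleftrightarrow> (\<forall>x \<in> dom_of S. p x x x = x)"

definition weak_nu :: "'a struct \<Rightarrow> nat \<Rightarrow> ('a list \<Rightarrow> 'a) \<Rightarrow> bool" where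
  "weak_nu S n w \<longleftrightarrow> n > 1 \<and> polymorphism S n w \<and>
     (\<forall>x \<in> dom_of S. w (replicate n x) = x) \<and>
     (\<forall>x \<in> dom_of S. \<forall>y \<in> dom_of S. \<forall>i<n. \<forall>j<n.
        w ((replicate n x)[i := y]) = w ((replicate n x)[j := y]))"

definition taylor :: "'a struct \<Rightarrow> bool" where
  "taylor S \<longleftrightarrow> (\<exists>n w. weak_nu S n w)"

definition SD_meet :: "'a struct \<Rightarrow> bool" where
  "SD_meet S \<longleftrightarrow> (\<exists>w1 w2. weak_nu S 3 w1 \<and> weak_nu S 4 w2 \<and>
     (\<forall>x \<in> dom_of S. \<forall>y \<in> dom_of S. w1 [y, x, x] = w2 [y, x, x, x]))"

definition hobby_mckenzie :: "'a struct \<Rightarrow> bool" where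
  "hobby_mckenzie S \<longleftrightarrow> (\<exists>(n::nat) d p e.
     (\<forall>i\<le>n. pol3 S (d i) \<and> idem3 S (d i) \<and> pol3 S (e i) \<and> idem3 S (e i)) \<and>
     pol3 S p \<and> idem3 S p \<and>
     (\<forall>x \<in> dom_of S. \<forall>y \<in> dom_of S. \<forall>z \<in> dom_of S.
        x = d 0 x y z \<and> e n x y z = z \<and>
        (\<forall>i<n. even i \<longrightarrow> d i x y y = d (Suc i) x y y \<and> e i x y y = e (Suc i) x y y) \<and>
        (\<forall>i<n. odd i \<longrightarrow> d i x x y = d (Suc i) x x y \<and> e i x x y = e (Suc i) x x y) \<and>
        d n x y y = p x y y \<and> p x x y = e 0 x x y \<and>
        (\<forall>i<n. odd i \<longrightarrow> d i x y x = d (Suc i) x y x) \<and>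
        (\<forall>j<n. even j \<longrightarrow> e j x y x = e (Suc j) x y x)))"

definition SD_join :: "'a struct \<Rightarrow> bool" where
  "SD_join S \<longleftrightarrow> SD_meet S \<and> hobby_mckenzie S"

definition cong_n_perm :: "'a struct \<Rightarrow> nat \<Rightarrow> bool" where
  "cong_n_perm S n \<longleftrightarrow> (\<exists>p. (\<forall>i\<le>n. pol3 S (p i)) \<and>
     (\<forall>x \<in> dom_of S. \<forall>y \<in> dom_of S. \<forall>z \<in> dom_of S.
        p 0 x y z = x \<and> (\<forall>i<n. p i x x y = p (Suc i) x y y) \<and> p n x y z = z))"

definition CnP :: "'a struct \<Rightarrow> bool" where
  "CnP S \<longleftrightarrow> (\<exists>n. cong_n_perm S n)"

definition maltsev :: "'a struct \<Rightarrow> bool" where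
  "maltsev S \<longleftrightarrow> cong_n_perm S 2"

definition CD :: "'a struct \<Rightarrow> bool" where
  "CD S \<longleftrightarrow> (\<exists>(n::nat) J. (\<forall>i\<le>n. pol3 S (J i)) \<and>
     (\<forall>x \<in> dom_of S. \<forall>y \<in> dom_of S. \<forall>z \<in> dom_of S.
        J 0 x y z = x \<and> (\<forall>i\<le>n. J i x y x = x) \<and>
        (\<forall>i<n. even i \<longrightarrow> J i x x y = J (Suc i) x x y) \<and>
        (\<forall>i<n. odd i \<longrightarrow> J i x y y = J (Suc i) x y y) \<and>
        J n x y z = z))"

definition CM :: "'a struct \<Rightarrow> bool" where
  "CM S \<longleftrightarrow> (\<exists>(n::nat) s p. (\<forall>i\<le>2*n. pol3 S (s i)) \<and> pol3 S p \<and>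
     (\<forall>x \<in> dom_of S. \<forall>y \<in> dom_of S. \<forall>z \<in> dom_of S.
        s 0 x y z = x \<and> (\<forall>i\<le>2*n. s i x y x = x) \<and>
        (\<forall>i<2*n. even i \<longrightarrow> s i x y y = s (Suc i) x y y) \<and>
        (\<forall>i<2*n. odd i \<longrightarrow> s i x x y = s (Suc i) x x y) \<and>
        s (2*n) x y y = p x y y \<and> p x x y = y))"

datatype property =
    Taylor | SDmeet | HobbyMcKenzie | SDjoin | CongMod | CnPerm | CongDist
  | SDjoin_CnP | CnP_CM | CD_CnP | C3P | CD_C3P | Maltsev | Arithmetical

fun has_prop :: "property \<Rightarrow> 'a struct \<Rightarrow> bool" where
  "has_prop Taylor S = taylor S"
| "has_prop SDmeet S = SD_meet S"
| "has_prop HobbyMcKenzie S = hobby_mckenzie S"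
| "has_prop SDjoin S = SD_join S"
| "has_prop CongMod S = CM S"
| "has_prop CnPerm S = CnP S"
| "has_prop CongDist S = CD S"
| "has_prop SDjoin_CnP S = (SD_join S \<and> CnP S)"
| "has_prop CnP_CM S = (CnP S \<and> CM S)"
| "has_prop CD_CnP S = (CD S \<and> CnP S)"
| "has_prop C3P S = cong_n_perm S 3"
| "has_prop CD_C3P S = (CD S \<and> cong_n_perm S 3)"
| "has_prop Maltsev S = maltsev S"
| "has_prop Arithmetical S = (CD S \<and> maltsev S)"

end

theory Submission
  imports Defs "HOL-Library.FuncSet"
begin

text \<open>
  An edge of the union joins elements of the same side, so the left/right pattern of a tuple is the
  same for two tuples that are coordinatewise adjacent. Hence an operation that acts by given
  polymorphisms on the tuples inside one side, and on a mixed tuple by a projection that depends on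
  its pattern only, is a polymorphism. Two-variable identities on mixed arguments then reduce to
  identities between idempotent operations on a two-element set, where projections, the minority,
  the majority and the minimum operation suffice. Conversely, the unary relations
  let one restrict polymorphisms to each side.

  Chains of ternary operations are brought to a common length by repeating the last one. For weak
  near-unanimity operations of different arities \<open>n\<close> and \<open>m\<close>, write
  \<open>x \<circ> y = w(y, x, \<dots>, x)\<close>. By finiteness, some iterated self-composition of \<open>w\<close> satisfies
  \<open>x \<circ> (x \<circ> y) = x \<circ> y\<close>; nesting such an operation in its first argument yields weak
  near-unanimity operations of all arities \<open>1 + j(n - 1)\<close>, and \<open>1 + (n - 1)(m - 1)\<close> is a common one.
\<close>

section \<open>Chains witnessing the ternary conditions\<close>

text \<open>The length and the operations become parameters here and in the next two chain
  predicates, so that chains can be restricted, lengthened and glued separately. The first identity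
  is turned round compared with \<open>hobby_mckenzie\<close>, so that it rewrites an operation to a
  variable.\<close>

definition hm_chain :: "'a struct \<Rightarrow> nat \<Rightarrow> (nat \<Rightarrow> 'a \<Rightarrow> 'a \<Rightarrow> 'a \<Rightarrow> 'a) \<Rightarrow> ('a \<Rightarrow> 'a \<Rightarrow> 'a \<Rightarrow> 'a) \<Rightarrow>
    (nat \<Rightarrow> 'a \<Rightarrow> 'a \<Rightarrow> 'a \<Rightarrow> 'a) \<Rightarrow> bool" where
  "hm_chain S n d p e \<longleftrightarrow>
     (\<forall>i\<le>n. pol3 S (d i) \<and> idem3 S (d i) \<and> pol3 S (e i) \<and> idem3 S (e i)) \<and>
     pol3 S p \<and> idem3 S p \<and>
     (\<forall>x \<in> dom_of S. \<forall>y \<in> dom_of S. \<forall>z \<in> dom_of S.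
        d 0 x y z = x \<and> e n x y z = z \<and>
        (\<forall>i<n. even i \<longrightarrow> d i x y y = d (Suc i) x y y \<and> e i x y y = e (Suc i) x y y) \<and>
        (\<forall>i<n. odd i \<longrightarrow> d i x x y = d (Suc i) x x y \<and> e i x x y = e (Suc i) x x y) \<and>
        d n x y y = p x y y \<and> p x x y = e 0 x x y \<and>
        (\<forall>i<n. odd i \<longrightarrow> d i x y x = d (Suc i) x y x) \<and>
        (\<forall>j<n. even j \<longrightarrow> e j x y x = e (Suc j) x y x))"

lemma hobby_mckenzie_iff: "hobby_mckenzie S \<longleftrightarrow> (\<exists>n d p e. hm_chain S n d p e)"
proof -
  have "(x = d 0 x y z) = (d 0 x y z = x)" for d :: "nat \<Rightarrow> 'a \<Rightarrow> 'a \<Rightarrow> 'a \<Rightarrow> 'a" and x y z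
    by (rule eq_commute)
  then show ?thesis by (simp only: hobby_mckenzie_def hm_chain_def)
qed

definition jonsson :: "'a struct \<Rightarrow> nat \<Rightarrow> (nat \<Rightarrow> 'a \<Rightarrow> 'a \<Rightarrow> 'a \<Rightarrow> 'a) \<Rightarrow> bool" where
  "jonsson S n J \<longleftrightarrow> (\<forall>i\<le>n. pol3 S (J i)) \<and>
     (\<forall>x \<in> dom_of S. \<forall>y \<in> dom_of S. \<forall>z \<in> dom_of S.
        J 0 x y z = x \<and> (\<forall>i\<le>n. J i x y x = x) \<and>
        (\<forall>i<n. even i \<longrightarrow> J i x x y = J (Suc i) x x y) \<and>
        (\<forall>i<n. odd i \<longrightarrow> J i x y y = J (Suc i) x y y) \<and>
        J n x y z = z)"

lemma CD_iff: "CD S \<longleftrightarrow> (\<exists>n J. jonsson S n J)"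
  by (simp only: CD_def jonsson_def)

definition gumm :: "'a struct \<Rightarrow> nat \<Rightarrow> (nat \<Rightarrow> 'a \<Rightarrow> 'a \<Rightarrow> 'a \<Rightarrow> 'a) \<Rightarrow> ('a \<Rightarrow> 'a \<Rightarrow> 'a \<Rightarrow> 'a) \<Rightarrow> bool"
  where "gumm S n s p \<longleftrightarrow> (\<forall>i\<le>2*n. pol3 S (s i)) \<and> pol3 S p \<and>
     (\<forall>x \<in> dom_of S. \<forall>y \<in> dom_of S. \<forall>z \<in> dom_of S.
        s 0 x y z = x \<and> (\<forall>i\<le>2*n. s i x y x = x) \<and>
        (\<forall>i<2*n. even i \<longrightarrow> s i x y y = s (Suc i) x y y) \<and>
        (\<forall>i<2*n. odd i \<longrightarrow> s i x x y = s (Suc i) x x y) \<and>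
        s (2*n) x y y = p x y y \<and> p x x y = y)"

lemma CM_iff: "CM S \<longleftrightarrow> (\<exists>n s p. gumm S n s p)"
  by (simp only: CM_def gumm_def)

section \<open>Restriction to a side\<close>

text \<open>Properties pass from \<open>T\<close> to \<open>S\<close>. Identities survive the
  pullback because equal values of operations stay equal under \<open>inv \<iota>\<close>, and a
  value \<open>\<iota> x\<close> returns to \<open>x\<close>. Two cases matter: a side of the union,
  and the identity map that forgets the unary relations.\<close>

definition pol_retract :: "('a \<Rightarrow> 'c) \<Rightarrow> 'a struct \<Rightarrow> 'c struct \<Rightarrow> bool" where
  "pol_retract \<iota> S T \<longleftrightarrow> inj \<iota> \<and> \<iota> ` dom_of S \<subseteq> dom_of T \<and>
     (\<forall>k h. polymorphism T k h \<longrightarrow> polymorphism S k (\<lambda>xs. inv \<iota> (h (map \<iota> xs))))"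

definition pull3 :: "('a \<Rightarrow> 'c) \<Rightarrow> ('c \<Rightarrow> 'c \<Rightarrow> 'c \<Rightarrow> 'c) \<Rightarrow> 'a \<Rightarrow> 'a \<Rightarrow> 'a \<Rightarrow> 'a" where
  "pull3 \<iota> p x y z = inv \<iota> (p (\<iota> x) (\<iota> y) (\<iota> z))"

lemma polymorphism_cong:
  assumes "\<And>xs. length xs = k \<Longrightarrow> f xs = g xs"
  shows "polymorphism S k f \<longleftrightarrow> polymorphism S k g"
  by (simp add: polymorphism_def assms)

lemma pol3_pull3:
  assumes "pol_retract \<iota> S T" "pol3 T p"
  shows "pol3 S (pull3 \<iota> p)"
proof -
  have "polymorphism S 3 (\<lambda>xs. inv \<iota> (p (map \<iota> xs ! 0) (map \<iota> xs ! 1) (map \<iota> xs ! 2)))"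
    using assms unfolding pol_retract_def pol3_def by blast
  \<comment> \<open>Evaluating \<open>map \<iota> xs ! i\<close> needs \<open>i < length xs\<close>,
    so the two operations are compared on lists of length three only.\<close>
  then show ?thesis
    unfolding pol3_def pull3_def by (rule polymorphism_cong[THEN iffD1, rotated]) simp
qed

lemma pol_retract_dom: "pol_retract \<iota> S T \<Longrightarrow> x \<in> dom_of S \<Longrightarrow> \<iota> x \<in> dom_of T"
  unfolding pol_retract_def by blast

lemma pol_retract_inv: "pol_retract \<iota> S T \<Longrightarrow> inv \<iota> (\<iota> x) = x"
  unfolding pol_retract_def by simp

lemma idem3_pull3:
  assumes "pol_retract \<iota> S T" "idem3 T p"
  shows "idem3 S (pull3 \<iota> p)"
  using assms pol_retract_dom[OF assms(1)] pol_retract_inv[OF assms(1)]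
  unfolding idem3_def pull3_def by simp

lemma weak_nu_retract:
  assumes r: "pol_retract \<iota> S T" and w: "weak_nu T n w"
  shows "weak_nu S n (\<lambda>xs. inv \<iota> (w (map \<iota> xs)))"
  unfolding weak_nu_def
proof (intro conjI ballI allI impI)
  show "n > 1" "polymorphism S n (\<lambda>xs. inv \<iota> (w (map \<iota> xs)))"
    using r w unfolding weak_nu_def pol_retract_def by blast+
next
  fix x assume "x \<in> dom_of S"
  then have "w (replicate n (\<iota> x)) = \<iota> x"
    using w pol_retract_dom[OF r] unfolding weak_nu_def by blast
  then show "inv \<iota> (w (map \<iota> (replicate n x))) = x"
    by (simp add: pol_retract_inv[OF r])
next
  fix x y i j assume "x \<in> dom_of S" "y \<in> dom_of S" "i < n" "j < n"
  then have "w ((replicate n (\<iota> x))[i := \<iota> y]) = w ((replicate n (\<iota> x))[j := \<iota> y])"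
    using w pol_retract_dom[OF r] unfolding weak_nu_def by blast
  then show "inv \<iota> (w (map \<iota> ((replicate n x)[i := y]))) = inv \<iota> (w (map \<iota> ((replicate n x)[j := y])))"
    by (simp add: map_update)
qed

lemma taylor_retract: "pol_retract \<iota> S T \<Longrightarrow> taylor T \<Longrightarrow> taylor S"
  unfolding taylor_def using weak_nu_retract by blast

lemma SD_meet_retract:
  assumes r: "pol_retract \<iota> S T" and "SD_meet T"
  shows "SD_meet S"
proof -
  obtain w1 w2 where w: "weak_nu T 3 w1" "weak_nu T 4 w2"
    and eq: "\<forall>x \<in> dom_of T. \<forall>y \<in> dom_of T. w1 [y, x, x] = w2 [y, x, x, x]"
    using assms(2) unfolding SD_meet_def by blast
  let ?u1 = "\<lambda>xs. inv \<iota> (w1 (map \<iota> xs))" and ?u2 = "\<lambda>xs. inv \<iota> (w2 (map \<iota> xs))"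
  have "\<forall>x \<in> dom_of S. \<forall>y \<in> dom_of S. ?u1 [y, x, x] = ?u2 [y, x, x, x]"
    by (simp add: eq pol_retract_dom[OF r])
  then show ?thesis unfolding SD_meet_def
    using weak_nu_retract[OF r w(1)] weak_nu_retract[OF r w(2)]
    by (intro exI[of _ ?u1] exI[of _ ?u2] conjI)
qed

text \<open>With \<open>Q\<close> arbitrary, all identities of a chain are transported at
  once.\<close>

lemma ball3_retract:
  assumes "pol_retract \<iota> S T" "\<forall>x \<in> dom_of T. \<forall>y \<in> dom_of T. \<forall>z \<in> dom_of T. Q x y z"
    and "x \<in> dom_of S" "y \<in> dom_of S" "z \<in> dom_of S"
  shows "Q (\<iota> x) (\<iota> y) (\<iota> z)"
  using assms pol_retract_dom by metis

lemma cong_n_perm_retract: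
  assumes r: "pol_retract \<iota> S T" and "cong_n_perm T n"
  shows "cong_n_perm S n"
proof -
  obtain p where ops: "\<forall>i\<le>n. pol3 T (p i)"
    and eq: "\<forall>x \<in> dom_of T. \<forall>y \<in> dom_of T. \<forall>z \<in> dom_of T.
        p 0 x y z = x \<and> (\<forall>i<n. p i x x y = p (Suc i) x y y) \<and> p n x y z = z"
    using assms(2) unfolding cong_n_perm_def by blast
  show ?thesis unfolding cong_n_perm_def
  proof (intro exI[of _ "\<lambda>i. pull3 \<iota> (p i)"] conjI ballI)
    fix x y z assume "x \<in> dom_of S" "y \<in> dom_of S" "z \<in> dom_of S"
    from ball3_retract[OF r eq this]
    show "pull3 \<iota> (p 0) x y z = x" "pull3 \<iota> (p n) x y z = z"
      "\<forall>i<n. pull3 \<iota> (p i) x x y = pull3 \<iota> (p (Suc i)) x y y"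
      by (simp_all add: pull3_def pol_retract_inv[OF r])
  qed (use ops pol3_pull3[OF r] in blast)
qed

lemma hm_chain_retract:
  assumes r: "pol_retract \<iota> S T" and c: "hm_chain T n d p e"
  shows "hm_chain S n (\<lambda>i. pull3 \<iota> (d i)) (pull3 \<iota> p) (\<lambda>i. pull3 \<iota> (e i))"
  unfolding hm_chain_def
proof (intro conjI[OF _ conjI[OF _ conjI[OF _ ballI[OF ballI[OF ballI]]]]])
  fix x y z assume "x \<in> dom_of S" "y \<in> dom_of S" "z \<in> dom_of S"
  note ball3_retract[OF r c[unfolded hm_chain_def, THEN conjunct2, THEN conjunct2, THEN conjunct2] this]
  then show "pull3 \<iota> (d 0) x y z = x \<and> pull3 \<iota> (e n) x y z = z \<and>
      (\<forall>i<n. even i \<longrightarrow> pull3 \<iota> (d i) x y y = pull3 \<iota> (d (Suc i)) x y y \<and>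
        pull3 \<iota> (e i) x y y = pull3 \<iota> (e (Suc i)) x y y) \<and>
      (\<forall>i<n. odd i \<longrightarrow> pull3 \<iota> (d i) x x y = pull3 \<iota> (d (Suc i)) x x y \<and>
        pull3 \<iota> (e i) x x y = pull3 \<iota> (e (Suc i)) x x y) \<and>
      pull3 \<iota> (d n) x y y = pull3 \<iota> p x y y \<and> pull3 \<iota> p x x y = pull3 \<iota> (e 0) x x y \<and>
      (\<forall>i<n. odd i \<longrightarrow> pull3 \<iota> (d i) x y x = pull3 \<iota> (d (Suc i)) x y x) \<and>
      (\<forall>j<n. even j \<longrightarrow> pull3 \<iota> (e j) x y x = pull3 \<iota> (e (Suc j)) x y x)"
    by (simp add: pull3_def pol_retract_inv[OF r])
qed (use c pol3_pull3[OF r] idem3_pull3[OF r] in \<open>auto simp: hm_chain_def\<close>)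

lemma jonsson_retract:
  assumes r: "pol_retract \<iota> S T" and c: "jonsson T n J"
  shows "jonsson S n (\<lambda>i. pull3 \<iota> (J i))"
  unfolding jonsson_def
proof (intro conjI[OF _ ballI[OF ballI[OF ballI]]])
  fix x y z assume "x \<in> dom_of S" "y \<in> dom_of S" "z \<in> dom_of S"
  note ball3_retract[OF r c[unfolded jonsson_def, THEN conjunct2] this]
  then show "pull3 \<iota> (J 0) x y z = x \<and> (\<forall>i\<le>n. pull3 \<iota> (J i) x y x = x) \<and>
      (\<forall>i<n. even i \<longrightarrow> pull3 \<iota> (J i) x x y = pull3 \<iota> (J (Suc i)) x x y) \<and>
      (\<forall>i<n. odd i \<longrightarrow> pull3 \<iota> (J i) x y y = pull3 \<iota> (J (Suc i)) x y y) \<and>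
      pull3 \<iota> (J n) x y z = z"
    by (simp add: pull3_def pol_retract_inv[OF r])
qed (use c pol3_pull3[OF r] in \<open>auto simp: jonsson_def\<close>)

lemma gumm_retract:
  assumes r: "pol_retract \<iota> S T" and c: "gumm T n s p"
  shows "gumm S n (\<lambda>i. pull3 \<iota> (s i)) (pull3 \<iota> p)"
  unfolding gumm_def
proof (intro conjI[OF _ conjI[OF _ ballI[OF ballI[OF ballI]]]])
  fix x y z assume "x \<in> dom_of S" "y \<in> dom_of S" "z \<in> dom_of S"
  note ball3_retract[OF r c[unfolded gumm_def, THEN conjunct2, THEN conjunct2] this]
  then show "pull3 \<iota> (s 0) x y z = x \<and> (\<forall>i\<le>2*n. pull3 \<iota> (s i) x y x = x) \<and>
      (\<forall>i<2*n. even i \<longrightarrow> pull3 \<iota> (s i) x y y = pull3 \<iota> (s (Suc i)) x y y) \<and>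
      (\<forall>i<2*n. odd i \<longrightarrow> pull3 \<iota> (s i) x x y = pull3 \<iota> (s (Suc i)) x x y) \<and>
      pull3 \<iota> (s (2*n)) x y y = pull3 \<iota> p x y y \<and> pull3 \<iota> p x x y = y"
    by (simp add: pull3_def pol_retract_inv[OF r])
qed (use c pol3_pull3[OF r] in \<open>auto simp: gumm_def\<close>)

lemma hobby_mckenzie_retract: "pol_retract \<iota> S T \<Longrightarrow> hobby_mckenzie T \<Longrightarrow> hobby_mckenzie S"
  unfolding hobby_mckenzie_iff using hm_chain_retract by blast

lemma CD_retract: "pol_retract \<iota> S T \<Longrightarrow> CD T \<Longrightarrow> CD S"
  unfolding CD_iff using jonsson_retract by blast

lemma CM_retract: "pol_retract \<iota> S T \<Longrightarrow> CM T \<Longrightarrow> CM S"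
  unfolding CM_iff using gumm_retract by blast

lemma CnP_retract: "pol_retract \<iota> S T \<Longrightarrow> CnP T \<Longrightarrow> CnP S"
  unfolding CnP_def using cong_n_perm_retract by blast

lemma has_prop_retract:
  assumes "pol_retract \<iota> S T" and "has_prop P T"
  shows "has_prop P S"
  using assms(2) taylor_retract[OF assms(1)] SD_meet_retract[OF assms(1)]
    hobby_mckenzie_retract[OF assms(1)] cong_n_perm_retract[OF assms(1)] CnP_retract[OF assms(1)]
    CD_retract[OF assms(1)] CM_retract[OF assms(1)]
  by (cases P) (auto simp: SD_join_def maltsev_def)

section \<open>The two unions and their retracts\<close>

lemma dom_struct_of [simp]: "dom_of (struct_of G) = fst G"
  and rel_struct_of [simp]: "rel_of (struct_of G) = snd G"
  and unaries_struct_of [simp]: "unaries_of (struct_of G) = []"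
  by (simp_all add: dom_of_def rel_of_def unaries_of_def struct_of_def)

lemma dom_ounion [simp]: "dom_of (ounion G H) = Inl ` fst G \<union> Inr ` fst H"
  and rel_ounion: "rel_of (ounion G H) =
    (\<lambda>(x, y). (Inl x, Inl y)) ` snd G \<union> (\<lambda>(x, y). (Inr x, Inr y)) ` snd H"
  and unaries_ounion [simp]: "unaries_of (ounion G H) = [Inl ` fst G, Inr ` fst H]"
  by (simp_all add: dom_of_def rel_of_def unaries_of_def ounion_def dunion_def)

lemma rel_ounion_simps [simp]:
  "(Inl a, Inl b) \<in> rel_of (ounion G H) \<longleftrightarrow> (a, b) \<in> snd G"
  "(Inr c, Inr d) \<in> rel_of (ounion G H) \<longleftrightarrow> (c, d) \<in> snd H"
  "(Inl a, Inr d) \<notin> rel_of (ounion G H)"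
  "(Inr c, Inl b) \<notin> rel_of (ounion G H)"
  by (auto simp: rel_ounion)

text \<open>Both structures have the same elements and edges; dropping the unary relations only
  removes conditions on polymorphisms.\<close>

lemma pol_retract_dunion: "pol_retract id (struct_of (dunion G H)) (ounion G H)"
  by (auto simp: pol_retract_def polymorphism_def rel_ounion dunion_def)

lemma pol_retract_side:
  assumes "inj \<iota>" and sub: "snd G \<subseteq> fst G \<times> fst G"
    and "\<iota> ` fst G \<subseteq> dom_of T" "\<iota> ` fst G \<in> set (unaries_of T)"
    and rel: "\<And>a b. (\<iota> a, \<iota> b) \<in> rel_of T \<longleftrightarrow> (a, b) \<in> snd G"
  shows "pol_retract \<iota> (struct_of G) T"
  unfolding pol_retract_def
proof (intro conjI allI impI)
  fix k h assume h: "polymorphism T k h"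
  have ex: "\<exists>a \<in> fst G. h (map \<iota> xs) = \<iota> a" if "length xs = k" "set xs \<subseteq> fst G" for xs
  proof -
    have "h (map \<iota> xs) \<in> \<iota> ` fst G"
      using h assms(4) that unfolding polymorphism_def by (simp add: image_mono)
    then show ?thesis by blast
  qed
  show "polymorphism (struct_of G) k (\<lambda>xs. inv \<iota> (h (map \<iota> xs)))"
    unfolding polymorphism_def
  proof (intro conjI allI impI ballI)
    fix xs assume "length xs = k \<and> set xs \<subseteq> dom_of (struct_of G)"
    then show "inv \<iota> (h (map \<iota> xs)) \<in> dom_of (struct_of G)"
      using ex[of xs] assms(1) by auto
  next
    fix xs ys assume *: "length xs = k \<and> length ys = k \<and>
      (\<forall>i<k. (xs ! i, ys ! i) \<in> rel_of (struct_of G))"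
    \<comment> \<open>Endpoints of edges are vertices, so \<open>ex\<close> applies to both
      tuples.\<close>
    then have "xs ! i \<in> fst G \<and> ys ! i \<in> fst G" if "i < k" for i
      using sub that by auto
    then have "set xs \<subseteq> fst G" "set ys \<subseteq> fst G"
      using * by (auto simp: in_set_conv_nth)
    then obtain a b where ab: "h (map \<iota> xs) = \<iota> a" "h (map \<iota> ys) = \<iota> b"
      using ex * by metis
    have "(h (map \<iota> xs), h (map \<iota> ys)) \<in> rel_of T"
      using h * rel unfolding polymorphism_def by simp
    then show "(inv \<iota> (h (map \<iota> xs)), inv \<iota> (h (map \<iota> ys))) \<in> rel_of (struct_of G)"
      using assms(1) rel ab by simp
  qed simp
qed (use assms in auto)

section \<open>Gluing operations of the two sides\<close>

text \<open>The selector returns a position and sees only the sides of the arguments, not the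
  arguments themselves. The empty list falls under the first clause.\<close>

definition sum_op ::
    "(bool list \<Rightarrow> nat) \<Rightarrow> ('a list \<Rightarrow> 'a) \<Rightarrow> ('b list \<Rightarrow> 'b) \<Rightarrow> ('a + 'b) list \<Rightarrow> 'a + 'b" where
  "sum_op \<sigma> f g xs =
     (if list_all isl xs then Inl (f (map projl xs))
      else if list_all (Not \<circ> isl) xs then Inr (g (map projr xs))
      else xs ! \<sigma> (map isl xs))"

text \<open>Only mixed patterns are constrained, since \<open>sum_op\<close> consults
  \<open>\<sigma>\<close> on no others.\<close>

definition selector :: "nat \<Rightarrow> (bool list \<Rightarrow> nat) \<Rightarrow> bool" where
  "selector k \<sigma> \<longleftrightarrow> 0 < k \<and>
     (\<forall>bs. length bs = k \<and> True \<in> set bs \<and> False \<in> set bs \<longrightarrow> \<sigma> bs < k)"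

lemma sum_op_Inl: "sum_op \<sigma> f g (map Inl xs) = Inl (f xs)"
  by (simp add: sum_op_def list_all_iff comp_def)

lemma sum_op_Inr: "xs \<noteq> [] \<Longrightarrow> sum_op \<sigma> f g (map Inr xs) = Inr (g xs)"
  by (cases xs) (auto simp: sum_op_def list_all_iff comp_def)

lemma sum_op_mixed:
  assumes "Inl a \<in> set xs" "Inr b \<in> set xs"
  shows "sum_op \<sigma> f g xs = xs ! \<sigma> (map isl xs)"
proof -
  have "\<not> list_all isl xs" "\<not> list_all (Not \<circ> isl) xs"
    using assms by (force simp: list_all_iff)+
  then show ?thesis by (simp add: sum_op_def)
qed

lemma sum_list_cases:
  fixes xs :: "('a + 'b) list"
  obtains (Inl) as where "xs = map Inl as"
  | (Inr) bs where "xs = map Inr bs" "bs \<noteq> []"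
  | (mixed) a b where "Inl a \<in> set xs" "Inr b \<in> set xs"
proof -
  have l: "xs = map Inl (map projl xs)" if "list_all isl xs"
    using that by (simp add: list_all_iff map_idI)
  have r: "xs = map Inr (map projr xs)" if "list_all (Not \<circ> isl) xs"
    using that by (simp add: list_all_iff map_idI)
  consider "list_all isl xs" | "list_all (Not \<circ> isl) xs" "xs \<noteq> []"
    | "\<not> list_all isl xs" "\<not> list_all (Not \<circ> isl) xs" by fastforce
  then show thesis
  proof cases
    case 1 then show thesis using l Inl by blast
  next
    case 2 then show thesis using r Inr by (metis map_is_Nil_conv)
  next
    case 3
    then obtain x y where "x \<in> set xs" "\<not> isl x" "y \<in> set xs" "isl y"
      by (auto simp: list_all_iff)
    then show thesis using mixed by (metis isl_def sum.collapse(2))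
  qed
qed

lemma polymorphism_sum_op:
  assumes f: "polymorphism (struct_of G) k f" and g: "polymorphism (struct_of H) k g"
    and sel: "selector k \<sigma>"
  shows "polymorphism (ounion G H) k (sum_op \<sigma> f g)"
  unfolding polymorphism_def
proof (intro conjI allI impI ballI)
  fix xs :: "('a + 'b) list"
  assume *: "length xs = k \<and> set xs \<subseteq> dom_of (ounion G H)"
  show "sum_op \<sigma> f g xs \<in> dom_of (ounion G H)"
  proof (cases xs rule: sum_list_cases)
    case (Inl as)
    then have "set as \<subseteq> fst G" using * by auto
    then show ?thesis using Inl f * by (simp add: sum_op_Inl polymorphism_def)
  next
    case (Inr bs)
    then have "set bs \<subseteq> fst H" using * by auto
    then show ?thesis using Inr g * by (simp add: sum_op_Inr polymorphism_def)
  next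
    case (mixed a b)
    then have "True \<in> set (map isl xs)" "False \<in> set (map isl xs)" by force+
    then have "\<sigma> (map isl xs) < length xs" using sel * unfolding selector_def by auto
    then show ?thesis using * sum_op_mixed[OF mixed] by (metis nth_mem subsetD)
  qed
next
  fix xs ys :: "('a + 'b) list"
  assume *: "length xs = k \<and> length ys = k \<and> (\<forall>i<k. (xs ! i, ys ! i) \<in> rel_of (ounion G H))"
  have same: "isl x = isl y" if "(x, y) \<in> rel_of (ounion G H)" for x y
    using that by (auto simp: rel_ounion)
  \<comment> \<open>Equal patterns make both tuples use the same clause of \<open>sum_op\<close>,
    and the same coordinate if they are mixed.\<close>
  have pat: "map isl xs = map isl ys"
    using * same by (auto intro!: nth_equalityI)
  have set_eq: "isl ` set xs = isl ` set ys" using pat by (metis set_map)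
  show "(sum_op \<sigma> f g xs, sum_op \<sigma> f g ys) \<in> rel_of (ounion G H)"
  proof (cases xs rule: sum_list_cases)
    case (Inl as)
    have "isl y" if "y \<in> set ys" for y
    proof -
      have "isl y \<in> isl ` set xs" using that set_eq by simp
      then show ?thesis using Inl by auto
    qed
    then have "ys = map Inl (map projl ys)" by (simp add: map_idI)
    then obtain bs where ys: "ys = map Inl bs" by blast
    have "\<forall>i<k. (as ! i, bs ! i) \<in> snd G" using * Inl ys by auto
    then show ?thesis using Inl ys f * by (simp add: sum_op_Inl polymorphism_def)
  next
    case (Inr bs)
    have "\<not> isl y" if "y \<in> set ys" for y
    proof -
      have "isl y \<in> isl ` set xs" using that set_eq by simp
      then show ?thesis using Inr by auto
    qed
    then have "ys = map Inr (map projr ys)" by (simp add: map_idI)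
    moreover have "ys \<noteq> []" using * Inr by auto
    ultimately obtain cs where ys: "ys = map Inr cs" "cs \<noteq> []" by (metis map_is_Nil_conv)
    have "\<forall>i<k. (bs ! i, cs ! i) \<in> snd H" using * Inr ys by auto
    then show ?thesis using Inr ys g * by (simp add: sum_op_Inr polymorphism_def)
  next
    case (mixed a b)
    then have TF: "True \<in> set (map isl xs)" "False \<in> set (map isl xs)" by force+
    then have "True \<in> set (map isl ys)" "False \<in> set (map isl ys)" using pat by simp_all
    then obtain u v where "u \<in> set ys" "isl u" "v \<in> set ys" "\<not> isl v" by auto
    then have ys: "Inl (projl u) \<in> set ys" "Inr (projr v) \<in> set ys" by simp_all
    have "\<sigma> (map isl xs) < k" using sel TF * unfolding selector_def by auto
    then show ?thesis
      using * sum_op_mixed[OF mixed] sum_op_mixed[OF ys] pat by metis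
  qed
next
  fix U xs assume U: "U \<in> set (unaries_of (ounion G H))"
    and *: "length xs = k \<and> set xs \<subseteq> U"
  \<comment> \<open>An empty tuple would be given a value on the left, against the unary relation of
    the right side.\<close>
  have "xs \<noteq> []" using * sel by (auto simp: selector_def)
  consider "U = Inl ` fst G" | "U = Inr ` fst H" using U by auto
  then show "sum_op \<sigma> f g xs \<in> U"
  proof cases
    case 1
    then have "\<forall>x \<in> set xs. Inl (projl x) = x" using * by auto
    then have "xs = map Inl (map projl xs)" by (simp add: map_idI)
    then obtain as where as: "xs = map Inl as" by blast
    then have "set as \<subseteq> fst G" using * 1 by auto
    then show ?thesis using 1 as f * by (simp add: sum_op_Inl polymorphism_def)
  next
    case 2
    then have "\<forall>x \<in> set xs. Inr (projr x) = x" using * by auto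
    then have "xs = map Inr (map projr xs)" by (simp add: map_idI)
    then obtain bs where bs: "xs = map Inr bs" by blast
    then have "set bs \<subseteq> fst H" "bs \<noteq> []" using * 2 \<open>xs \<noteq> []\<close> by auto
    then show ?thesis using 2 bs g * by (simp add: sum_op_Inr polymorphism_def)
  qed
qed

section \<open>Weak near-unanimity operations\<close>

text \<open>On mixed patterns this picks the first left element, that is, the minimum for \<open>Inl < Inr\<close>.\<close>

definition first_left :: "bool list \<Rightarrow> nat" where
  "first_left bs = length (takeWhile Not bs)"

lemma first_left:
  assumes "True \<in> set bs"
  shows "first_left bs < length bs" "bs ! first_left bs"
proof -
  have "takeWhile Not bs \<noteq> bs" using assms by (metis set_takeWhileD)
  then show l: "first_left bs < length bs"
    unfolding first_left_def
    by (metis length_takeWhile_le linorder_neqE_nat not_le take_all_iff takeWhile_eq_take)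
  then show "bs ! first_left bs"
    unfolding first_left_def using nth_length_takeWhile by blast
qed

lemma selector_first_left: "0 < k \<Longrightarrow> selector k first_left"
  using first_left(1) by (auto simp: selector_def)

text \<open>In a near-constant mixed tuple the left value is unique even when it is repeated, so the
  result does not depend on where the exceptional entry stands.\<close>

lemma sum_op_first_left:
  assumes "Inl a \<in> set xs" "Inr b \<in> set xs" "\<And>a'. Inl a' \<in> set xs \<Longrightarrow> a' = a"
  shows "sum_op first_left f g xs = Inl a"
proof -
  have "True \<in> set (map isl xs)" using assms(1) by force
  note l = first_left[OF this]
  define x where "x = xs ! first_left (map isl xs)"
  have "x \<in> set xs" "isl x" using l by (simp_all add: x_def)
  then obtain c where "x = Inl c" by (auto simp: isl_def)
  then have "x = Inl a" using assms(3) \<open>x \<in> set xs\<close> by simp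
  then show ?thesis using sum_op_mixed[OF assms(1,2)] by (simp add: x_def)
qed

lemma set_replicate_update:
  assumes "i < n" "n > 1"
  shows "set ((replicate n x)[i := y]) = {x, y}"
proof
  show "set ((replicate n x)[i := y]) \<subseteq> {x, y}"
    using set_update_subset_insert[of "replicate n x" i y] by auto
  obtain j where j: "j < n" "j \<noteq> i" using assms
    by (metis less_trans less_one neq0_conv nat_neq_iff)
  then have "(replicate n x)[i := y] ! j = x" by simp
  moreover have "(replicate n x)[i := y] ! i = y" using assms by simp
  ultimately show "{x, y} \<subseteq> set ((replicate n x)[i := y])"
    using j assms by (metis empty_subsetI insert_subset length_list_update length_replicate nth_mem)
qed

text \<open>Two values on one side are handled by \<open>f\<close> or \<open>g\<close>. For values
  on different sides, the left one wins both when it is repeated (\<open>LR\<close>) and when it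
  stands alone (\<open>RL\<close>).\<close>

lemma weak_nu_sum_op:
  assumes f: "weak_nu (struct_of G) n f" and g: "weak_nu (struct_of H) n g"
  shows "weak_nu (ounion G H) n (sum_op first_left f g)"
proof -
  let ?w = "sum_op first_left f g"
  have n: "n > 1" using f by (simp add: weak_nu_def)
  have L: "?w ((replicate n (Inl x))[i := Inl y]) = Inl (f ((replicate n x)[i := y]))" for i x y
    using sum_op_Inl[of first_left f g "(replicate n x)[i := y]"] by (simp add: map_update)
  have R: "?w ((replicate n (Inr x))[i := Inr y]) = Inr (g ((replicate n x)[i := y]))" for i x y
    using sum_op_Inr[of "(replicate n x)[i := y]" first_left f g] n by (simp add: map_update)
  have LR: "?w ((replicate n (Inl x))[i := Inr y]) = Inl x" if "i < n" for i x y
    by (rule sum_op_first_left[of _ _ y]) (auto simp: set_replicate_update[OF that n])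
  have RL: "?w ((replicate n (Inr x))[i := Inl y]) = Inl y" if "i < n" for i x y
    by (rule sum_op_first_left[of _ _ x]) (auto simp: set_replicate_update[OF that n])
  have idem: "?w (replicate n z) = z" if "z \<in> dom_of (ounion G H)" for z
  proof (cases z)
    case (Inl x)
    then show ?thesis using that f sum_op_Inl[of first_left f g "replicate n x"]
      by (auto simp: weak_nu_def)
  next
    case (Inr x)
    then show ?thesis using that g n sum_op_Inr[of "replicate n x" first_left f g]
      by (auto simp: weak_nu_def)
  qed
  have "?w ((replicate n x)[i := y]) = ?w ((replicate n x)[j := y])"
    if "x \<in> dom_of (ounion G H)" "y \<in> dom_of (ounion G H)" "i < n" "j < n" for x y i j
  proof -
    have "f ((replicate n a)[i := b]) = f ((replicate n a)[j := b])"
      if "a \<in> fst G" "b \<in> fst G" for a b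
      using f that \<open>i < n\<close> \<open>j < n\<close> unfolding weak_nu_def dom_struct_of by blast
    moreover have "g ((replicate n a)[i := b]) = g ((replicate n a)[j := b])"
      if "a \<in> fst H" "b \<in> fst H" for a b
      using g that \<open>i < n\<close> \<open>j < n\<close> unfolding weak_nu_def dom_struct_of by blast
    ultimately show ?thesis
      using that by (cases x; cases y) (auto simp: L R LR RL)
  qed
  moreover have "polymorphism (ounion G H) n ?w"
    using f g n by (intro polymorphism_sum_op selector_first_left) (auto simp: weak_nu_def)
  ultimately show ?thesis using n idem unfolding weak_nu_def by blast
qed

text \<open>The arities are already fixed. On mixed arguments both sides of the linking identity
  equal the left one of \<open>x\<close> and \<open>y\<close>, because the minimum behaves alike in
  all arities.\<close>

lemma SD_meet_ounion:
  assumes "SD_meet (struct_of G)" "SD_meet (struct_of H)"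
  shows "SD_meet (ounion G H)"
proof -
  obtain w1 w2 where w: "weak_nu (struct_of G) 3 w1" "weak_nu (struct_of G) 4 w2"
    and wq: "\<forall>x \<in> fst G. \<forall>y \<in> fst G. w1 [y, x, x] = w2 [y, x, x, x]"
    using assms(1) unfolding SD_meet_def by auto
  obtain v1 v2 where v: "weak_nu (struct_of H) 3 v1" "weak_nu (struct_of H) 4 v2"
    and vq: "\<forall>x \<in> fst H. \<forall>y \<in> fst H. v1 [y, x, x] = v2 [y, x, x, x]"
    using assms(2) unfolding SD_meet_def by auto
  let ?u1 = "sum_op first_left w1 v1" and ?u2 = "sum_op first_left w2 v2"
  have "?u1 [y, x, x] = ?u2 [y, x, x, x]"
    if "x \<in> dom_of (ounion G H)" "y \<in> dom_of (ounion G H)" for x y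
  proof (cases x; cases y)
    fix a b assume "x = Inl a" "y = Inl b"
    then show ?thesis using that wq by (auto simp: sum_op_def)
  next
    fix a b assume "x = Inr a" "y = Inr b"
    then show ?thesis using that vq by (auto simp: sum_op_def)
  qed (auto simp: sum_op_def first_left_def)
  then show ?thesis unfolding SD_meet_def
    using weak_nu_sum_op[OF w(1) v(1)] weak_nu_sum_op[OF w(2) v(2)] by blast
qed

section \<open>Composition and change of arity\<close>

definition near :: "nat \<Rightarrow> ('a list \<Rightarrow> 'a) \<Rightarrow> 'a \<Rightarrow> 'a \<Rightarrow> 'a" where
  "near n w x y = w ((replicate n x)[0 := y])"

text \<open>\<open>near n w x y\<close> is the product \<open>x \<circ> y\<close> of the
  introduction; its choice of position 0 is a convention, as all positions agree.\<close>

lemma weak_nu_near: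
  "weak_nu S n w \<Longrightarrow> x \<in> dom_of S \<Longrightarrow> y \<in> dom_of S \<Longrightarrow> i < n \<Longrightarrow>
    w ((replicate n x)[i := y]) = near n w x y"
  unfolding weak_nu_def near_def by (metis less_trans zero_less_one)

text \<open>A common value \<open>h x y\<close> for all positions gives the symmetry and computes
  \<open>near\<close> at the same time.\<close>

lemma weak_nuI:
  assumes "n > 1" "polymorphism S n w" "\<And>x. x \<in> dom_of S \<Longrightarrow> w (replicate n x) = x"
    and "\<And>x y i. x \<in> dom_of S \<Longrightarrow> y \<in> dom_of S \<Longrightarrow> i < n \<Longrightarrow> w ((replicate n x)[i := y]) = h x y"
  shows "weak_nu S n w" "x \<in> dom_of S \<Longrightarrow> y \<in> dom_of S \<Longrightarrow> near n w x y = h x y"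
  using assms by (auto simp: weak_nu_def near_def)

lemma near_in_dom:
  assumes "weak_nu S n w" "x \<in> dom_of S" "y \<in> dom_of S"
  shows "near n w x y \<in> dom_of S"
proof -
  have "set ((replicate n x)[0 := y]) \<subseteq> dom_of S"
    using assms set_update_subset_insert[of "replicate n x" 0 y] by (auto simp: weak_nu_def)
  then show ?thesis using assms(1) by (simp add: near_def weak_nu_def polymorphism_def)
qed

text \<open>The star composition of two operations, its \<open>n * m\<close> arguments being
  arranged in \<open>n\<close> consecutive blocks of length \<open>m\<close>.\<close>

definition star :: "nat \<Rightarrow> ('a list \<Rightarrow> 'a) \<Rightarrow> nat \<Rightarrow> ('a list \<Rightarrow> 'a) \<Rightarrow> 'a list \<Rightarrow> 'a" where
  "star n w m v xs = w (map (\<lambda>i. v (map (\<lambda>j. xs ! (i * m + j)) [0..<m])) [0..<n])"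

lemma block_index: "i < n \<Longrightarrow> j < m \<Longrightarrow> i * m + j < n * (m::nat)"
proof -
  assume "i < n" "j < m"
  then have "i * m + j < Suc i * m" by simp
  also have "\<dots> \<le> n * m" using \<open>i < n\<close> by (intro mult_le_mono1) simp
  finally show ?thesis .
qed

lemma polymorphism_star:
  assumes w: "polymorphism S n w" and v: "polymorphism S m v"
  shows "polymorphism S (n * m) (star n w m v)"
proof -
  have sub: "set (map (\<lambda>j. xs ! (i * m + j)) [0..<m]) \<subseteq> U"
    if "length xs = n * m" "set xs \<subseteq> U" "i < n" for xs i and U :: "'a set"
    using that block_index[OF \<open>i < n\<close>] nth_mem[of _ xs] by auto
  show ?thesis
    unfolding polymorphism_def
  proof (intro conjI allI impI ballI)
    fix xs assume *: "length xs = n * m \<and> set xs \<subseteq> dom_of S"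
    have "v (map (\<lambda>j. xs ! (i * m + j)) [0..<m]) \<in> dom_of S" if "i < n" for i
      using v sub[of xs "dom_of S" i] * that unfolding polymorphism_def by simp
    then show "star n w m v xs \<in> dom_of S"
      using w unfolding polymorphism_def star_def by (simp add: image_subset_iff)
  next
    fix xs ys assume *: "length xs = n * m \<and> length ys = n * m \<and>
      (\<forall>i<n * m. (xs ! i, ys ! i) \<in> rel_of S)"
    have "(v (map (\<lambda>j. xs ! (i * m + j)) [0..<m]), v (map (\<lambda>j. ys ! (i * m + j)) [0..<m])) \<in> rel_of S"
      if "i < n" for i
      using v * block_index[OF that] unfolding polymorphism_def by simp
    then show "(star n w m v xs, star n w m v ys) \<in> rel_of S"
      using w unfolding polymorphism_def star_def by simp
  next
    fix U xs assume U: "U \<in> set (unaries_of S)" and *: "length xs = n * m \<and> set xs \<subseteq> U"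
    have "v (map (\<lambda>j. xs ! (i * m + j)) [0..<m]) \<in> U" if "i < n" for i
      using v U sub[of xs U i] * that unfolding polymorphism_def by simp
    then show "star n w m v xs \<in> U"
      using w U unfolding polymorphism_def star_def by (simp add: image_subset_iff)
  qed
qed

text \<open>In a near-constant tuple only one block is not constant. Idempotence of \<open>v\<close>
  turns every other block into \<open>x\<close>, so \<open>w\<close> again receives a near-constant
  tuple, with exceptional entry \<open>near m v x y\<close>.\<close>

lemma weak_nu_star:
  assumes w: "weak_nu S n w" and v: "weak_nu S m v"
  shows "weak_nu S (n * m) (star n w m v)"
    and "x \<in> dom_of S \<Longrightarrow> y \<in> dom_of S \<Longrightarrow>
      near (n * m) (star n w m v) x y = near n w x (near m v x y)"
proof -
  have nm: "n > 1" "m > 1" using w v by (auto simp: weak_nu_def)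
  have pos: "n * m > 1" using nm by (metis One_nat_def less_1_mult)
  have pol: "polymorphism S (n * m) (star n w m v)"
    using w v by (intro polymorphism_star) (auto simp: weak_nu_def)
  have const: "map (\<lambda>j. replicate (n * m) x ! (i * m + j)) [0..<m] = replicate m x"
    if "i < n" for i and x :: 'a
    using block_index[OF that] by (intro nth_equalityI) auto
  have idem: "star n w m v (replicate (n * m) x) = x" if "x \<in> dom_of S" for x
  proof -
    have "map (\<lambda>i. v (map (\<lambda>j. replicate (n * m) x ! (i * m + j)) [0..<m])) [0..<n] = replicate n x"
      using v that const by (intro nth_equalityI) (auto simp: weak_nu_def)
    then show ?thesis using w that by (simp add: star_def weak_nu_def)
  qed
  have nu: "star n w m v ((replicate (n * m) x)[p := y]) = near n w x (near m v x y)"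
    if xy: "x \<in> dom_of S" "y \<in> dom_of S" and p: "p < n * m" for x y p
  proof -
    \<comment> \<open>Position \<open>p\<close> lies in block \<open>p div m\<close>, at place
      \<open>p mod m\<close> of it.\<close>
    let ?xs = "(replicate (n * m) x)[p := y]"
    have dm: "p div m < n" "p mod m < m"
      using p nm by (auto simp: less_mult_imp_div_less)
    have block: "map (\<lambda>j. ?xs ! (i * m + j)) [0..<m] =
        (if i = p div m then (replicate m x)[p mod m := y] else replicate m x)" if i: "i < n" for i
    proof (intro nth_equalityI)
      fix j assume "j < length (map (\<lambda>j. ?xs ! (i * m + j)) [0..<m])"
      then have j: "j < m" by simp
      have "i * m + j = p \<longleftrightarrow> i = p div m \<and> j = p mod m"
        using j nm by (metis add.commute add.right_neutral div_mult_mod_eq div_less div_mult_self3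
            gr_implies_not0 mod_less mod_mult_self3)
      then show "map (\<lambda>j. ?xs ! (i * m + j)) [0..<m] ! j =
        (if i = p div m then (replicate m x)[p mod m := y] else replicate m x) ! j"
        using block_index[OF i j] j p by (auto simp: nth_list_update)
    qed auto
    have "map (\<lambda>i. v (map (\<lambda>j. ?xs ! (i * m + j)) [0..<m])) [0..<n] =
        (replicate n x)[p div m := near m v x y]"
      using block v xy dm weak_nu_near[OF v xy dm(2)]
      by (intro nth_equalityI) (auto simp: weak_nu_def nth_list_update)
    then show ?thesis
      using weak_nu_near[OF w xy(1) near_in_dom[OF v xy] dm(1)] by (simp add: star_def)
  qed
  show "weak_nu S (n * m) (star n w m v)"
    using weak_nuI(1)[OF pos pol idem nu] by blast
  show "near (n * m) (star n w m v) x y = near n w x (near m v x y)"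
    if "x \<in> dom_of S" "y \<in> dom_of S"
    using weak_nuI(2)[OF pos pol idem nu that] by blast
qed

text \<open>Star composition with \<open>w\<close> applies the map \<open>near n w x\<close> once
  more and multiplies the arity by \<open>n\<close>. The exponent starts at one because a weak
  near-unanimity operation has arity above one.\<close>

lemma weak_nu_iterate:
  assumes w: "weak_nu S n w"
  shows "\<exists>v. weak_nu S (n ^ Suc k) v \<and>
    (\<forall>x \<in> dom_of S. \<forall>y \<in> dom_of S. near (n ^ Suc k) v x y = (near n w x ^^ Suc k) y)"
proof (induction k)
  case 0
  then show ?case using w by auto
next
  case (Suc k)
  then obtain v where v: "weak_nu S (n ^ Suc k) v"
    "\<forall>x \<in> dom_of S. \<forall>y \<in> dom_of S. near (n ^ Suc k) v x y = (near n w x ^^ Suc k) y" by blast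
  show ?case
    using weak_nu_star[OF w v(1)] v(2) by (intro exI[of _ "star n w (n ^ Suc k) v"]) simp
qed

text \<open>Two powers \<open>a < b\<close> of \<open>f\<close> agree on the finite set
  \<open>A\<close>, so from exponent \<open>a\<close> on the powers have period
  \<open>c = b - a\<close>. An exponent that is a multiple of \<open>c\<close> and at least
  \<open>a\<close> is then idempotent.\<close>

lemma finite_idempotent_power:
  assumes fin: "finite A" and f: "f \<in> A \<rightarrow> A"
  shows "\<exists>k. \<forall>x \<in> A. (f ^^ Suc k) ((f ^^ Suc k) x) = (f ^^ Suc k) x"
proof -
  have closed: "(f ^^ i) x \<in> A" if "x \<in> A" for i x
    using that f by (induction i) auto
  \<comment> \<open>Restricted to \<open>A\<close>, the powers lie in the finite space of
    extensional maps from \<open>A\<close> to \<open>A\<close>.\<close>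
  let ?r = "\<lambda>i. restrict (f ^^ i) A"
  have "range ?r \<subseteq> A \<rightarrow>\<^sub>E A" using closed by auto
  then have "finite (range ?r)" using fin by (meson finite_PiE finite_subset)
  then have "\<not> inj ?r" using finite_imageD infinite_UNIV_nat by blast
  then obtain a b where "a < b" and ab: "?r a = ?r b"
    unfolding inj_def by (metis linorder_neqE_nat)
  define c where "c = b - a"
  have c: "c > 0" "b = a + c" using \<open>a < b\<close> by (auto simp: c_def)
  have 1: "(f ^^ (a + c)) x = (f ^^ a) x" if "x \<in> A" for x
    using fun_cong[OF ab, of x] that c(2) by simp
  have per: "(f ^^ (d + a + t * c)) x = (f ^^ (d + a)) x" if "x \<in> A" for x d t
  proof (induction t)
    case (Suc t)
    have "(f ^^ (d + a + Suc t * c)) x = (f ^^ (d + t * c)) ((f ^^ (a + c)) x)"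
      by (simp add: funpow_add[THEN fun_cong, simplified comp_def, symmetric] algebra_simps)
    also have "\<dots> = (f ^^ (d + a + t * c)) x"
      using 1[OF that]
      by (simp add: funpow_add[THEN fun_cong, simplified comp_def, symmetric] algebra_simps)
    finally show ?case using Suc by simp
  qed simp
  \<comment> \<open>The factor \<open>Suc a\<close> ensures both \<open>K \<ge> a\<close> and
    \<open>K > 0\<close>, as \<open>c\<close> is positive.\<close>
  define K where "K = Suc a * c"
  have "K \<ge> a" "K > 0"  using c(1) by (cases c; simp add: K_def)+
  have "(f ^^ K) ((f ^^ K) x) = (f ^^ K) x" if "x \<in> A" for x
  proof -
    have "(f ^^ K) ((f ^^ K) x) = (f ^^ ((K - a) + a + Suc a * c)) x"
      using \<open>K \<ge> a\<close> by (simp add: funpow_add K_def)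
    then show ?thesis using per[OF that, of "K - a" "Suc a"] \<open>K \<ge> a\<close> by simp
  qed
  then show ?thesis using \<open>K > 0\<close> by (metis Suc_pred)
qed

text \<open>Weak near-unanimity operations with this extra identity are called special.\<close>

lemma special_weak_nu:
  assumes fin: "finite (dom_of S)" and w: "weak_nu S n w"
  obtains m v where "weak_nu S m v"
    "\<And>x y. x \<in> dom_of S \<Longrightarrow> y \<in> dom_of S \<Longrightarrow> near m v x (near m v x y) = near m v x y"
proof -
  \<comment> \<open>Acting on pairs, with \<open>x\<close> carried along, yields one exponent that
    serves all \<open>x\<close> simultaneously.\<close>
  let ?f = "\<lambda>(x, y). (x, near n w x y)"
  have "?f \<in> dom_of S \<times> dom_of S \<rightarrow> dom_of S \<times> dom_of S"
    using near_in_dom[OF w] by auto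
  from finite_idempotent_power[OF finite_cartesian_product[OF fin fin] this]
  obtain k where k: "\<forall>z \<in> dom_of S \<times> dom_of S. (?f ^^ Suc k) ((?f ^^ Suc k) z) = (?f ^^ Suc k) z"
    by blast
  have pow: "(?f ^^ i) (x, y) = (x, (near n w x ^^ i) y)" for i x y
    by (induction i) auto
  obtain v where v: "weak_nu S (n ^ Suc k) v"
    and nv: "\<forall>x \<in> dom_of S. \<forall>y \<in> dom_of S. near (n ^ Suc k) v x y = (near n w x ^^ Suc k) y"
    using weak_nu_iterate[OF w] by blast
  show thesis
  proof (rule that[OF v])
    fix x y assume xy: "x \<in> dom_of S" "y \<in> dom_of S"
    have "near (n ^ Suc k) v x (near (n ^ Suc k) v x y) =
        (near n w x ^^ Suc k) ((near n w x ^^ Suc k) y)"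
      using nv xy near_in_dom[OF v xy] by metis
    also have "\<dots> = (near n w x ^^ Suc k) y"
      using k xy unfolding pow by (metis (no_types, lifting) SigmaI pow snd_conv)
    finally show "near (n ^ Suc k) v x (near (n ^ Suc k) v x y) = near (n ^ Suc k) v x y"
      using nv xy by metis
  qed
qed

text \<open>Here \<open>w\<close> has arity \<open>Suc l\<close>. Each nesting fills the first place
  of a new copy of \<open>w\<close> and adds \<open>l\<close> places, so depth \<open>j\<close> has
  arity \<open>Suc (j * l)\<close>; depth 0 is the unary identity.\<close>

fun nest :: "nat \<Rightarrow> ('a list \<Rightarrow> 'a) \<Rightarrow> nat \<Rightarrow> 'a list \<Rightarrow> 'a" where
  "nest l w 0 xs = xs ! 0"
| "nest l w (Suc j) xs = w (nest l w j (take (Suc (j * l)) xs) # drop (Suc (j * l)) xs)"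

lemma polymorphism_nest:
  assumes w: "polymorphism S (Suc l) w"
  shows "polymorphism S (Suc (j * l)) (nest l w j)"
proof (induction j)
  case 0
  show ?case
    by (auto simp: polymorphism_def dest!: subsetD[OF _ nth_mem[of 0]])
next
  case (Suc j)
  let ?m = "Suc (j * l)"
  have sub: "set (take ?m xs) \<subseteq> U \<and> set (drop ?m xs) \<subseteq> U" if "set xs \<subseteq> U" for xs and U :: "'a set"
    using that set_take_subset set_drop_subset by fast
  show ?case
    unfolding polymorphism_def
  proof (intro conjI allI impI ballI)
    fix xs assume *: "length xs = Suc (Suc j * l) \<and> set xs \<subseteq> dom_of S"
    then have "nest l w j (take ?m xs) \<in> dom_of S"
      using Suc sub[of xs "dom_of S"] unfolding polymorphism_def by simp
    then show "nest l w (Suc j) xs \<in> dom_of S"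
      using w * sub[of xs "dom_of S"] unfolding polymorphism_def by simp
  next
    fix xs ys assume *: "length xs = Suc (Suc j * l) \<and> length ys = Suc (Suc j * l) \<and>
      (\<forall>i<Suc (Suc j * l). (xs ! i, ys ! i) \<in> rel_of S)"
    then have "(nest l w j (take ?m xs), nest l w j (take ?m ys)) \<in> rel_of S"
      using Suc unfolding polymorphism_def by simp
    then have "\<forall>i<Suc l. ((nest l w j (take ?m xs) # drop ?m xs) ! i,
        (nest l w j (take ?m ys) # drop ?m ys) ! i) \<in> rel_of S"
      using * by (auto simp: nth_Cons split: nat.split)
    then show "(nest l w (Suc j) xs, nest l w (Suc j) ys) \<in> rel_of S"
      using w * unfolding polymorphism_def by simp
  next
    fix U xs assume U: "U \<in> set (unaries_of S)"
      and *: "length xs = Suc (Suc j * l) \<and> set xs \<subseteq> U"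
    then have "nest l w j (take ?m xs) \<in> U"
      using Suc sub[of xs U] unfolding polymorphism_def by simp
    then show "nest l w (Suc j) xs \<in> U"
      using w U * sub[of xs U] unfolding polymorphism_def by simp
  qed
qed

text \<open>A lone \<open>y\<close> becomes \<open>near (Suc l) w x y\<close> in the copy of
  \<open>w\<close> that receives it directly. Every further copy applies
  \<open>near (Suc l) w x\<close> again, which changes nothing by \<open>special\<close>. Thus all
  positions give the same value.\<close>

lemma weak_nu_nest:
  assumes w: "weak_nu S (Suc l) w"
    and special: "\<And>x y. x \<in> dom_of S \<Longrightarrow> y \<in> dom_of S \<Longrightarrow>
      near (Suc l) w x (near (Suc l) w x y) = near (Suc l) w x y"
    and "j > 0"
  shows "weak_nu S (Suc (j * l)) (nest l w j)"
proof -
  have l: "l > 0" using w by (simp add: weak_nu_def)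
  have idem: "nest l w j (replicate (Suc (j * l)) x) = x" if "x \<in> dom_of S" for x j
  proof (induction j)
    case (Suc j)
    have "w (replicate (Suc l) x) = x" using w that by (simp add: weak_nu_def)
    then show ?case using Suc by simp
  qed simp
  \<comment> \<open>At depth 0 no copy of \<open>w\<close> has acted yet, so the value is still
    \<open>y\<close>; the induction needs this case.\<close>
  have nu: "nest l w j ((replicate (Suc (j * l)) x)[i := y]) =
      (if j = 0 then y else near (Suc l) w x y)"
    if xy: "x \<in> dom_of S" "y \<in> dom_of S" and "i < Suc (j * l)" for x y i j
    using that(3)
  proof (induction j arbitrary: i)
    case (Suc j)
    let ?m = "Suc (j * l)"
    have rep: "take ?m (replicate (Suc (Suc j * l)) x) = replicate ?m x"
      "drop ?m (replicate (Suc (Suc j * l)) x) = replicate l x" by simp_all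
    show ?case
    proof (cases "i < ?m")
      \<comment> \<open>The lone \<open>y\<close> lies in the nested part and enters the outer
        \<open>w\<close> through its first argument.\<close>
      case True
      let ?z = "if j = 0 then y else near (Suc l) w x y"
      have "nest l w (Suc j) ((replicate (Suc (Suc j * l)) x)[i := y]) = w (?z # replicate l x)"
        using Suc.IH[OF True] True rep
        by (simp only: nest.simps take_update_swap drop_update_cancel)
      also have "\<dots> = near (Suc l) w x ?z" by (simp add: near_def)
      also have "\<dots> = near (Suc l) w x y" using special[OF xy] by simp
      finally show ?thesis by simp
    next
      \<comment> \<open>The nested part is constant and collapses to \<open>x\<close>; the lone
        \<open>y\<close> is a direct argument of the outer \<open>w\<close>.\<close>
      case False
      have "nest l w (Suc j) ((replicate (Suc (Suc j * l)) x)[i := y]) =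
          w (x # (replicate l x)[i - ?m := y])"
        using False rep idem[OF xy(1), of j]
        by (simp only: nest.simps take_update_cancel not_less drop_update_swap)
      also have "\<dots> = w ((replicate (Suc l) x)[Suc (i - ?m) := y])" by simp
      also have "\<dots> = near (Suc l) w x y"
        using Suc.prems False by (intro weak_nu_near[OF w xy]) auto
      finally show ?thesis by simp
    qed
  qed simp
  show ?thesis
  proof (rule weak_nuI(1))
    show "Suc (j * l) > 1" using l \<open>j > 0\<close> by simp
    show "polymorphism S (Suc (j * l)) (nest l w j)"
      using w by (intro polymorphism_nest) (simp add: weak_nu_def)
    show "nest l w j ((replicate (Suc (j * l)) x)[i := y]) = near (Suc l) w x y"
      if "x \<in> dom_of S" "y \<in> dom_of S" "i < Suc (j * l)" for x y i
      using nu[OF that] \<open>j > 0\<close> by simp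
  qed (rule idem)
qed

text \<open>Here \<open>l\<close> is one less than the arity of a special operation, and
  \<open>j\<close> is the depth of nesting.\<close>

lemma taylor_arities:
  assumes "finite (dom_of S)" "taylor S"
  obtains l where "l > 0" "\<And>j. j > 0 \<Longrightarrow> \<exists>w. weak_nu S (Suc (j * l)) w"
proof -
  obtain n w where "weak_nu S n w" using assms(2) unfolding taylor_def by blast
  from special_weak_nu[OF assms(1) this] obtain m v where v: "weak_nu S m v"
    "\<And>x y. x \<in> dom_of S \<Longrightarrow> y \<in> dom_of S \<Longrightarrow> near m v x (near m v x y) = near m v x y"
    by blast
  have "m > 1" using v(1) by (simp add: weak_nu_def)
  then have m: "Suc (m - 1) = m" by simp
  show thesis
    by (rule that[of "m - 1"])
      (use \<open>m > 1\<close> weak_nu_nest[of S "m - 1" v, unfolded m, OF v] in auto)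
qed

lemma taylor_ounion:
  assumes "finite (fst G)" "finite (fst H)" "taylor (struct_of G)" "taylor (struct_of H)"
  shows "taylor (ounion G H)"
proof -
  obtain l where l: "l > 0" "\<And>j. j > 0 \<Longrightarrow> \<exists>w. weak_nu (struct_of G) (Suc (j * l)) w"
    using taylor_arities[OF _ assms(3)] assms(1) by auto
  obtain m where m: "m > 0" "\<And>j. j > 0 \<Longrightarrow> \<exists>w. weak_nu (struct_of H) (Suc (j * m)) w"
    using taylor_arities[OF _ assms(4)] assms(2) by auto
  \<comment> \<open>Depth \<open>m\<close> on the left and depth \<open>l\<close> on the right lead
    to the same arity.\<close>
  obtain w v where "weak_nu (struct_of G) (Suc (m * l)) w" "weak_nu (struct_of H) (Suc (m * l)) v"
    using l(2)[OF m(1)] m(2)[OF l(1)] by (metis mult.commute)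
  then show ?thesis unfolding taylor_def using weak_nu_sum_op by blast
qed

section \<open>Chains of ternary operations\<close>

definition sum_op3 :: "(bool list \<Rightarrow> nat) \<Rightarrow> ('a \<Rightarrow> 'a \<Rightarrow> 'a \<Rightarrow> 'a) \<Rightarrow> ('b \<Rightarrow> 'b \<Rightarrow> 'b \<Rightarrow> 'b) \<Rightarrow>
    'a + 'b \<Rightarrow> 'a + 'b \<Rightarrow> 'a + 'b \<Rightarrow> 'a + 'b" where
  "sum_op3 \<sigma> p q x y z =
     sum_op \<sigma> (\<lambda>xs. p (xs ! 0) (xs ! 1) (xs ! 2)) (\<lambda>xs. q (xs ! 0) (xs ! 1) (xs ! 2)) [x, y, z]"

text \<open>On a mixed pattern this is the position of the argument that is alone on its
  side.\<close>

definition minority :: "bool list \<Rightarrow> nat" where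
  "minority bs = (if bs ! 1 = bs ! 2 then 0 else if bs ! 0 = bs ! 1 then 2 else 1)"

text \<open>If the first two sides differ, the third argument is on the majority side. Which
  position of that side is returned makes no difference in two-variable identities between values on
  different sides.\<close>

definition majority :: "bool list \<Rightarrow> nat" where
  "majority bs = (if bs ! 0 = bs ! 1 then 0 else 2)"

lemma selector3:
  "selector 3 minority" "selector 3 majority" "selector 3 (\<lambda>_. 0)" "selector 3 (\<lambda>_. 2)"
  by (auto simp: selector_def minority_def majority_def)

lemma pol3_sum_op3:
  assumes "pol3 (struct_of G) p" "pol3 (struct_of H) q" "selector 3 \<sigma>"
  shows "pol3 (ounion G H) (sum_op3 \<sigma> p q)"
proof -
  have "[xs ! 0, xs ! 1, xs ! 2] = xs" if "length xs = 3" for xs :: "('a + 'b) list"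
    using that by (auto simp: numeral_3_eq_3 numeral_2_eq_2 length_Suc_conv)
  then show ?thesis
    using polymorphism_sum_op[OF assms(1,2)[unfolded pol3_def] assms(3)]
    unfolding pol3_def sum_op3_def by (simp cong: polymorphism_cong)
qed

text \<open>With all side patterns as rewrite rules, a mixed identity is checked by evaluating
  \<open>\<sigma>\<close> on explicit patterns.\<close>

lemma sum_op3_simps [simp]:
  "sum_op3 \<sigma> p q (Inl a) (Inl b) (Inl c) = Inl (p a b c)"
  "sum_op3 \<sigma> p q (Inr a') (Inr b') (Inr c') = Inr (q a' b' c')"
  "sum_op3 \<sigma> p q (Inl a) (Inl b) (Inr c') = [Inl a, Inl b, Inr c'] ! \<sigma> [True, True, False]"
  "sum_op3 \<sigma> p q (Inl a) (Inr b') (Inl c) = [Inl a, Inr b', Inl c] ! \<sigma> [True, False, True]"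
  "sum_op3 \<sigma> p q (Inl a) (Inr b') (Inr c') = [Inl a, Inr b', Inr c'] ! \<sigma> [True, False, False]"
  "sum_op3 \<sigma> p q (Inr a') (Inl b) (Inl c) = [Inr a', Inl b, Inl c] ! \<sigma> [False, True, True]"
  "sum_op3 \<sigma> p q (Inr a') (Inl b) (Inr c') = [Inr a', Inl b, Inr c'] ! \<sigma> [False, True, False]"
  "sum_op3 \<sigma> p q (Inr a') (Inr b') (Inl c) = [Inr a', Inr b', Inl c] ! \<sigma> [False, False, True]"
  by (simp_all add: sum_op3_def sum_op_def)

lemma idem3_sum_op3:
  assumes "idem3 (struct_of G) p" "idem3 (struct_of H) q"
  shows "idem3 (ounion G H) (sum_op3 \<sigma> p q)"
  using assms by (auto simp: idem3_def)

text \<open>The last operation may be repeated because it is the third projection: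
  \<open>p n x x y\<close> and \<open>p n x y y\<close> are both \<open>y\<close>.\<close>

lemma cong_n_perm_mono:
  assumes "cong_n_perm S n" "n \<le> m"
  shows "cong_n_perm S m"
proof -
  obtain p where p: "\<forall>i\<le>n. pol3 S (p i)" "\<forall>x \<in> dom_of S. \<forall>y \<in> dom_of S. \<forall>z \<in> dom_of S.
        p 0 x y z = x \<and> (\<forall>i<n. p i x x y = p (Suc i) x y y) \<and> p n x y z = z"
    using assms(1) unfolding cong_n_perm_def by blast
  show ?thesis unfolding cong_n_perm_def
    by (rule exI[of _ "\<lambda>i. p (min i n)"]) (use p assms(2) in \<open>auto simp: min_def not_less_eq_eq\<close>)
qed

text \<open>On mixed arguments the chain is first projection, minority, then third projections. The
  minority is a Maltsev operation on two elements: it gives \<open>x\<close> on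
  \<open>x, y, y\<close> and \<open>y\<close> on \<open>x, x, y\<close>. The bound
  \<open>n \<ge> 2\<close> leaves room for these three steps.\<close>

lemma cong_n_perm_ounion:
  assumes "cong_n_perm (struct_of G) n" "cong_n_perm (struct_of H) n" "n \<ge> 2"
  shows "cong_n_perm (ounion G H) n"
proof -
  obtain p where p: "\<forall>i\<le>n. pol3 (struct_of G) (p i)" "\<forall>x \<in> fst G. \<forall>y \<in> fst G. \<forall>z \<in> fst G.
        p 0 x y z = x \<and> (\<forall>i<n. p i x x y = p (Suc i) x y y) \<and> p n x y z = z"
    using assms(1) unfolding cong_n_perm_def by auto
  obtain q where q: "\<forall>i\<le>n. pol3 (struct_of H) (q i)" "\<forall>x \<in> fst H. \<forall>y \<in> fst H. \<forall>z \<in> fst H.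
        q 0 x y z = x \<and> (\<forall>i<n. q i x x y = q (Suc i) x y y) \<and> q n x y z = z"
    using assms(2) unfolding cong_n_perm_def by auto
  define \<sigma> where "\<sigma> i = (if i = 0 then \<lambda>_. 0 else if i = 1 then minority else (\<lambda>_. 2))" for i :: nat
  have "selector 3 (\<sigma> i)" for i by (simp add: \<sigma>_def selector3)
  then have "\<forall>i\<le>n. pol3 (ounion G H) (sum_op3 (\<sigma> i) (p i) (q i))"
    using p(1) q(1) pol3_sum_op3 by blast
  then show ?thesis unfolding cong_n_perm_def
    by (intro exI[of _ "\<lambda>i. sum_op3 (\<sigma> i) (p i) (q i)"])
      (use p(2) q(2) \<open>n \<ge> 2\<close> in \<open>auto simp: \<sigma>_def minority_def\<close>)
qed

lemma CnP_ounion: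
  assumes "CnP (struct_of G)" "CnP (struct_of H)"
  shows "CnP (ounion G H)"
proof -
  obtain n m where "cong_n_perm (struct_of G) n" "cong_n_perm (struct_of H) m"
    using assms unfolding CnP_def by blast
  then show ?thesis unfolding CnP_def
    \<comment> \<open>The summand 2 secures the minimal length for gluing.\<close>
    by (intro exI[of _ "n + m + 2"] cong_n_perm_ounion) (auto elim: cong_n_perm_mono)
qed

text \<open>This serves links that compare neighbouring operations at the same arguments, with the
  parity of the index as \<open>P\<close>. Beyond \<open>n\<close> both sides are
  \<open>f n\<close>.\<close>

lemma repeat_last:
  fixes f :: "nat \<Rightarrow> 'a"
  assumes "\<forall>i<n. P i \<longrightarrow> f i = f (Suc i)"
  shows "\<forall>i. P i \<longrightarrow> f (min i n) = f (min (Suc i) n)"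
proof (intro allI impI)
  fix i assume "P i"
  with assms show "f (min i n) = f (min (Suc i) n)" by (cases "i < n") auto
qed

lemma jonsson_mono:
  assumes "jonsson S n J" "n \<le> m"
  shows "jonsson S m (\<lambda>i. J (min i n))"
proof -
  have "\<forall>x \<in> dom_of S. \<forall>y \<in> dom_of S.
      (\<forall>i. even i \<longrightarrow> J (min i n) x x y = J (min (Suc i) n) x x y) \<and>
      (\<forall>i. odd i \<longrightarrow> J (min i n) x y y = J (min (Suc i) n) x y y)"
    by (intro ballI conjI; rule repeat_last; use assms(1) in \<open>unfold jonsson_def, blast\<close>)
  moreover have "min m n = n" using assms(2) by simp
  ultimately show ?thesis using assms(1) unfolding jonsson_def by simp
qed

lemma CD_ounion:
  assumes "CD (struct_of G)" "CD (struct_of H)"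
  shows "CD (ounion G H)"
proof -
  obtain n0 m0 J0 K0 where JK0: "jonsson (struct_of G) n0 J0" "jonsson (struct_of H) m0 K0"
    using assms unfolding CD_iff by blast
  define n where "n = n0 + m0 + 2"
  obtain J K where J: "jonsson (struct_of G) n J" and K: "jonsson (struct_of H) n K"
    using jonsson_mono[OF JK0(1), of n] jonsson_mono[OF JK0(2), of n] by (auto simp: n_def)
  have "n \<ge> 2" by (simp add: n_def)
  \<comment> \<open>The majority agrees with the first projection on \<open>x, x, y\<close> (link at
    index 0) and with the third on \<open>x, y, y\<close> (link at index 1); all three give
    \<open>x\<close> on \<open>x, y, x\<close>.\<close>
  define \<sigma> where "\<sigma> i = (if i = 0 then \<lambda>_. 0 else if i = 1 then majority else (\<lambda>_. 2))" for i :: nat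
  have "selector 3 (\<sigma> i)" for i by (simp add: \<sigma>_def selector3)
  then have "\<forall>i\<le>n. pol3 (ounion G H) (sum_op3 (\<sigma> i) (J i) (K i))"
    using J K unfolding jonsson_def by (simp add: pol3_sum_op3)
  then have "jonsson (ounion G H) n (\<lambda>i. sum_op3 (\<sigma> i) (J i) (K i))"
    using J K \<open>n \<ge> 2\<close> unfolding jonsson_def by (auto simp: \<sigma>_def majority_def)
  then show ?thesis unfolding CD_iff by blast
qed

lemma gumm_mono:
  assumes "gumm S n s p" "n \<le> m"
  shows "gumm S m (\<lambda>i. s (min i (2 * n))) p"
proof -
  have "\<forall>x \<in> dom_of S. \<forall>y \<in> dom_of S.
      (\<forall>i. even i \<longrightarrow> s (min i (2*n)) x y y = s (min (Suc i) (2*n)) x y y) \<and>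
      (\<forall>i. odd i \<longrightarrow> s (min i (2*n)) x x y = s (min (Suc i) (2*n)) x x y)"
    by (intro ballI conjI; rule repeat_last; use assms(1) in \<open>unfold gumm_def, blast\<close>)
  moreover have "min (2*m) (2*n) = 2*n" using assms(2) by simp
  ultimately show ?thesis using assms(1) unfolding gumm_def by simp
qed

text \<open>On mixed arguments every \<open>s i\<close> is the first projection and \<open>p\<close>
  the minority, which gives \<open>x\<close> on \<open>x, y, y\<close> and \<open>y\<close> on
  \<open>x, x, y\<close>, as the last two identities demand.\<close>

lemma CM_ounion:
  assumes "CM (struct_of G)" "CM (struct_of H)"
  shows "CM (ounion G H)"
proof -
  obtain n0 m0 s0 t0 p q where
    st0: "gumm (struct_of G) n0 s0 p" "gumm (struct_of H) m0 t0 q"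
    using assms unfolding CM_iff by blast
  define n where "n = n0 + m0"
  obtain s t where s: "gumm (struct_of G) n s p" and t: "gumm (struct_of H) n t q"
    using gumm_mono[OF st0(1), of n] gumm_mono[OF st0(2), of n] by (auto simp: n_def)
  have "\<forall>i\<le>2*n. pol3 (ounion G H) (sum_op3 (\<lambda>_. 0) (s i) (t i))"
    "pol3 (ounion G H) (sum_op3 minority p q)"
    using s t pol3_sum_op3 selector3 unfolding gumm_def by blast+
  then have "gumm (ounion G H) n (\<lambda>i. sum_op3 (\<lambda>_. 0) (s i) (t i)) (sum_op3 minority p q)"
    using s t unfolding gumm_def by (auto simp: minority_def)
  then show ?thesis unfolding CM_iff by blast
qed

lemma hm_chain_mono:
  assumes "hm_chain S n d p e" "n \<le> m"
  shows "hm_chain S m (\<lambda>i. d (min i n)) p (\<lambda>i. e (min i n))"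
proof -
  have "\<forall>x \<in> dom_of S. \<forall>y \<in> dom_of S.
      (\<forall>i. even i \<longrightarrow> d (min i n) x y y = d (min (Suc i) n) x y y) \<and>
      (\<forall>i. even i \<longrightarrow> e (min i n) x y y = e (min (Suc i) n) x y y) \<and>
      (\<forall>i. odd i \<longrightarrow> d (min i n) x x y = d (min (Suc i) n) x x y) \<and>
      (\<forall>i. odd i \<longrightarrow> e (min i n) x x y = e (min (Suc i) n) x x y) \<and>
      (\<forall>i. odd i \<longrightarrow> d (min i n) x y x = d (min (Suc i) n) x y x) \<and>
      (\<forall>i. even i \<longrightarrow> e (min i n) x y x = e (min (Suc i) n) x y x)"
    by (intro ballI conjI; rule repeat_last; use assms(1) in \<open>unfold hm_chain_def, blast\<close>)
  moreover have "min m n = n" using assms(2) by simp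
  ultimately show ?thesis using assms(1) unfolding hm_chain_def by simp
qed

text \<open>On mixed arguments the \<open>d i\<close> are first projections and the
  \<open>e i\<close> third projections, so links inside each half are trivial; the minority bridges
  the halves.\<close>

lemma hobby_mckenzie_ounion:
  assumes "hobby_mckenzie (struct_of G)" "hobby_mckenzie (struct_of H)"
  shows "hobby_mckenzie (ounion G H)"
proof -
  obtain n0 m0 d0 d0' p p' e0 e0' where
    c0: "hm_chain (struct_of G) n0 d0 p e0" "hm_chain (struct_of H) m0 d0' p' e0'"
    using assms unfolding hobby_mckenzie_iff by blast
  define n where "n = n0 + m0"
  obtain d e d' e' where
    c: "hm_chain (struct_of G) n d p e" and c': "hm_chain (struct_of H) n d' p' e'"
    using hm_chain_mono[OF c0(1), of n] hm_chain_mono[OF c0(2), of n] by (auto simp: n_def)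
  let ?d = "\<lambda>i. sum_op3 (\<lambda>_. 0) (d i) (d' i)" and ?e = "\<lambda>i. sum_op3 (\<lambda>_. 2) (e i) (e' i)"
    and ?p = "sum_op3 minority p p'"
  have "\<forall>i\<le>n. pol3 (ounion G H) (?d i) \<and> idem3 (ounion G H) (?d i) \<and>
      pol3 (ounion G H) (?e i) \<and> idem3 (ounion G H) (?e i)"
    "pol3 (ounion G H) ?p" "idem3 (ounion G H) ?p"
    using c c' unfolding hm_chain_def by (simp_all add: pol3_sum_op3 idem3_sum_op3 selector3)
  then have "hm_chain (ounion G H) n ?d ?p ?e"
    using c c' unfolding hm_chain_def by (auto simp: minority_def)
  then show ?thesis unfolding hobby_mckenzie_iff by blast
qed

section \<open>All properties together\<close>

lemma has_prop_ounion:
  assumes "finite (fst G)" "finite (fst H)"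
    and "has_prop P (struct_of G)" "has_prop P (struct_of H)"
  shows "has_prop P (ounion G H)"
  using assms(3,4) taylor_ounion[OF assms(1,2)]
  by (cases P) (simp_all add: SD_join_def maltsev_def SD_meet_ounion hobby_mckenzie_ounion
      CM_ounion CnP_ounion CD_ounion cong_n_perm_ounion)

theorem theorem4p3:
  fixes G :: "'a digraph" and H :: "'b digraph" and P :: property
  assumes "digraph G" and "digraph H"
  shows "(has_prop P (struct_of G) \<and> has_prop P (struct_of H) \<longrightarrow>
            has_prop P (struct_of (dunion G H)) \<and> has_prop P (ounion G H)) \<and>
         (\<not> has_prop P (struct_of G) \<or> \<not> has_prop P (struct_of H) \<longrightarrow>
            \<not> has_prop P (ounion G H))"
proof -
  have "pol_retract Inl (struct_of G) (ounion G H)" "pol_retract Inr (struct_of H) (ounion G H)"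
    by (rule pol_retract_side; use assms in \<open>auto simp: digraph_def\<close>)+
  \<comment> \<open>The retracts onto the sides give the last claim by contraposition; the third one
    carries the property from \<open>ounion G H\<close> to \<open>dunion G H\<close>.\<close>
  note this[THEN has_prop_retract, of P] has_prop_retract[OF pol_retract_dunion, of P G H]
  moreover have "finite (fst G)" "finite (fst H)" using assms by (auto simp: digraph_def)
  note has_prop_ounion[OF this, of P]
  ultimately show ?thesis by blast
qed

end
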